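(* For every integer $n\ge 2$, $$a(n+2)+a(n-2)>2a(n),$$ where $a(m)$ denotes the number of cubic partitions of $m$.
   Context: For an integer $m\ge 0$, $a(m)$ (the number of cubic partitions of $m$) is the number of partitions of $m$ in which every even part may carry one of two labels (colours), with $a(0)=1$. Equivalently, the integers $a(m)$ are defined by the generating function $$\sum_{m=0}^{\infty}a(m)x^{m}=\prod_{i=1}^{\infty}\frac{1}{(1-x^{i})(1-x^{2i})},\qquad |x|<1.$$ *)

theory Defs
  imports Complex_Main "HOL-Library.Multiset"
begin

text \<open>
  A coloured part is a pair \<open>(k, c)\<close> of a positive integer and a label; the second label
  (\<open>c = True\<close>) is available only when \<open>k\<close> is even.
\<close>

definition cubic_partitions :: "nat \<Rightarrow> (nat \<times> bool) multiset set" where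
  "cubic_partitions m =
     {P. (\<forall>(k, c) \<in># P. k > 0 \<and> (c \<longrightarrow> even k)) \<and> (\<Sum>(k, c) \<in># P. k) = m}"

definition a :: "nat \<Rightarrow> nat" where
  "a m = card (cubic_partitions m)"

text \<open>Finiteness ensures that \<^const>\<open>card\<close> is a genuine count here.\<close>

lemma finite_cubic_partitions: "finite (cubic_partitions m)"
proof (rule finite_subset)
  let ?A = "{..m} \<times> (UNIV :: bool set)"
  show "cubic_partitions m \<subseteq> (\<Union>n\<in>{..m}. multisets_of_size ?A n)"
  proof
    fix P assume P: "P \<in> cubic_partitions m"
    then have pos: "\<forall>p \<in># P. fst p > 0" and sum: "(\<Sum>p \<in># P. fst p) = m"
      by (auto simp: cubic_partitions_def split_def)
    from pos have "size P \<le> (\<Sum>p \<in># P. fst p)"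
      by (induction P) auto
    moreover have "fst p \<le> m" if "p \<in># P" for p
    proof -
      from that obtain Q where "P = add_mset p Q" by (rule mset_add)
      with sum show ?thesis by simp
    qed
    ultimately show "P \<in> (\<Union>n\<in>{..m}. multisets_of_size ?A n)"
      using sum by (auto simp: multisets_of_size_def mem_Times_iff)
  qed
  show "finite (\<Union>n\<in>{..m}. multisets_of_size ?A n)"
    by (intro finite_UN_I finite_multisets_of_size) auto
qed

lemma a_0: "a 0 = 1"
proof -
  have "P = {#}" if "P \<in> cubic_partitions 0" for P
    using that by (cases P) (auto simp: cubic_partitions_def)
  moreover have "{#} \<in> cubic_partitions 0"
    by (simp add: cubic_partitions_def)
  ultimately have "cubic_partitions 0 = {{#}}" by blast
  then show ?thesis by (simp add: a_def)
qed

end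

theory Submission
  imports Defs
begin

text \<open>
  Multiplying the generating function by \<open>(1 - x\<^sup>2)\<^sup>2\<close> cancels the factors belonging to the two
  coloured parts of size 2. Hence the second difference \<open>a (n + 2) - 2 a n + a (n - 2)\<close> counts the
  cubic partitions of \<open>n + 2\<close> without parts of size 2, and the partition into ones is one of these.
\<close>

definition cubic_partitions_avoiding :: "(nat \<times> bool) set \<Rightarrow> nat \<Rightarrow> (nat \<times> bool) multiset set" where
  "cubic_partitions_avoiding S m = {P \<in> cubic_partitions m. set_mset P \<inter> S = {}}"

lemma finite_cubic_partitions_avoiding: "finite (cubic_partitions_avoiding S m)"
  using finite_cubic_partitions by (simp add: cubic_partitions_avoiding_def)

lemma cubic_partitions_avoiding_empty: "cubic_partitions_avoiding {} m = cubic_partitions m"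
  by (simp add: cubic_partitions_avoiding_def)

text \<open>Coefficient form of multiplying a generating function by \<open>1 - x^k\<close>: a
  partition either contains \<open>(k, c)\<close>, and deleting one copy leaves an arbitrary member
  of the family at \<open>m\<close>, or avoids it as well.\<close>

lemma card_cubic_partitions_avoiding_insert:
  assumes "k > 0" "c \<longrightarrow> even k" "(k, c) \<notin> S"
  shows "card (cubic_partitions_avoiding S (m + k)) =
    card (cubic_partitions_avoiding S m) + card (cubic_partitions_avoiding (insert (k, c) S) (m + k))"
proof -
  let ?A = "cubic_partitions_avoiding S" and ?B = "cubic_partitions_avoiding (insert (k, c) S)"
  \<comment> \<open>All three assumptions enter here: \<open>(k, c)\<close> is an admissible part
    outside \<open>S\<close>, so one copy can be added or deleted freely.\<close>
  have add_mem: "add_mset (k, c) P \<in> ?A (m + k) \<longleftrightarrow> P \<in> ?A m" for P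
    using assms by (auto simp: cubic_partitions_avoiding_def cubic_partitions_def)
  have "?A (m + k) = add_mset (k, c) ` ?A m \<union> ?B (m + k)"
  proof (intro equalityI subsetI)
    fix P assume P: "P \<in> ?A (m + k)"
    show "P \<in> add_mset (k, c) ` ?A m \<union> ?B (m + k)"
    proof (cases "(k, c) \<in># P")
      case True
      then obtain Q where "P = add_mset (k, c) Q" by (rule mset_add)
      with P show ?thesis by (simp add: add_mem)
    next
      case False
      with P show ?thesis by (simp add: cubic_partitions_avoiding_def)
    qed
  next
    fix P assume "P \<in> add_mset (k, c) ` ?A m \<union> ?B (m + k)"
    then show "P \<in> ?A (m + k)"
      by (auto simp: add_mem) (simp add: cubic_partitions_avoiding_def)
  qed
  moreover have "add_mset (k, c) ` ?A m \<inter> ?B (m + k) = {}"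
    by (auto simp: cubic_partitions_avoiding_def)
  moreover have "card (add_mset (k, c) ` ?A m) = card (?A m)"
    by (intro card_image inj_onI) simp
  ultimately show ?thesis
    by (simp add: card_Un_disjoint finite_cubic_partitions_avoiding)
qed

lemma replicate_one_in_cubic_partitions: "replicate_mset m (1, False) \<in> cubic_partitions m"
  by (induction m) (auto simp: cubic_partitions_def)

theorem theorem1p2:
  fixes n :: nat
  assumes "n \<ge> 2"
  shows "a (n + 2) + a (n - 2) > 2 * a n"
proof -
  \<comment> \<open>This turns the truncated subtraction \<open>n - 2\<close> into
    \<open>m\<close>.\<close>
  obtain m where n: "n = m + 2"
    using assms by (metis le_add_diff_inverse2)
  let ?B = "cubic_partitions_avoiding {(2, False)}"
    and ?C = "cubic_partitions_avoiding {(2, True), (2, False)}"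
  have a_step: "a (l + 2) = a l + card (?B (l + 2))" for l
    using card_cubic_partitions_avoiding_insert[of 2 False "{}" l]
    by (simp add: a_def cubic_partitions_avoiding_empty)
  have "card (?B (n + 2)) = card (?B n) + card (?C (n + 2))"
    using card_cubic_partitions_avoiding_insert[of 2 True "{(2, False)}" n] by simp
  moreover have "replicate_mset (n + 2) (1, False) \<in> ?C (n + 2)"
    using replicate_one_in_cubic_partitions[of "n + 2"]
    unfolding cubic_partitions_avoiding_def by (auto split: if_splits)
  then have "card (?C (n + 2)) > 0"
    using finite_cubic_partitions_avoiding card_gt_0_iff by blast
  \<comment> \<open>The two instances of \<open>a_step\<close> express the successive differences of
    \<open>a\<close> as \<open>card (?B (n + 2))\<close> and \<open>card (?B n)\<close>; these
    differ by \<open>card (?C (n + 2))\<close>, which is positive.\<close>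
  ultimately show ?thesis
    using a_step[of m] a_step[of n] n by simp
qed

end
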